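(* Let $\mathcal{H}=\mathbb{R}^n$ (Euclidean space), let $m\ge1$ be an integer, and let $T_1,\ldots,T_m:\mathcal{H}\to\mathcal{H}$ be affine isometries with $\bigcap_{i=1}^m\operatorname{Fix}T_i\ne\varnothing$. Let $t\ge1$ and let $q_0,\ldots,q_t$ be integers with $q_0=0$, $q_t=m$ and $q_i-q_{i-1}\ge1$ for all $i\in\{1,\ldots,t\}$. For $i\in\{1,\ldots,t\}$ set $$\mathcal{S}_i:=\{\mathrm{Id},\,T_{q_{i-1}+1},\,T_{q_{i-1}+2}T_{q_{i-1}+1},\,\ldots,\,T_{q_i}\cdots T_{q_{i-1}+2}T_{q_{i-1}+1}\}.$$ Let $G:\mathcal{H}\to\mathcal{H}$ be such that one of the following holds: (i) $G=CC_{\mathcal{S}_t}\circ CC_{\mathcal{S}_{t-1}}\circ\cdots\circ CC_{\mathcal{S}_1}$; (ii) $G=\sum_{i=1}^t\omega_iCC_{\mathcal{S}_i}$, where $\{\omega_i\}_{1\le i\le t}\subseteq\,]0,1]$ and $\sum_{i=1}^t\omega_i=1$. Then $\operatorname{Fix}G=\bigcap_{i=1}^m\operatorname{Fix}T_i$ and $G$ is a BAM. Moreover, there exists $\gamma\in[0,1[$ such that $$(\forall x\in\mathcal{H})(\forall k\in\mathbb{N})\quad\big\|G^kx-\mathrm{P}_{\bigcap_{i=1}^m\operatorname{Fix}T_i}x\big\|\le\gamma^k\big\|x-\mathrm{P}_{\bigcap_{i=1}^m\operatorname{Fix}T_i}x\big\|.$$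
   Context: For a nonempty closed convex set $C\subseteq\mathcal{H}$, $\mathrm{P}_C$ denotes the metric projection onto $C$. $\operatorname{Fix}G=\{x\in\mathcal{H}: Gx=x\}$. $\mathbb{N}=\{0,1,2,\ldots\}$. Products of operators denote composition. An isometry is a map $T$ with $\|Tx-Ty\|=\|x-y\|$ for all $x,y$. Definition (BAM). Let $G:\mathcal{H}\to\mathcal{H}$ and $\gamma\in[0,1[$. $G$ is a best approximation mapping with constant $\gamma$ ($\gamma$-BAM) if (1) $\operatorname{Fix}G$ is a nonempty closed convex subset of $\mathcal{H}$; (2) $\mathrm{P}_{\operatorname{Fix}G}G=\mathrm{P}_{\operatorname{Fix}G}$; (3) $\|Gx-\mathrm{P}_{\operatorname{Fix}G}x\|\le\gamma\|x-\mathrm{P}_{\operatorname{Fix}G}x\|$ for all $x\in\mathcal{H}$. $G$ is a BAM if it is a $\gamma$-BAM for some $\gamma\in[0,1[$. Circumcenter mapping: for a finite set $\mathcal{S}$ of affine isometries of $\mathcal{H}$ having a common fixed point, and $x\in\mathcal{H}$, $CC_{\mathcal{S}}x$ is the unique point $p$ in the affine hull of $\mathcal{S}(x)=\{Tx:T\in\mathcal{S}\}$ such that $\{\|p-Tx\|:T\in\mathcal{S}\}$ is a singleton. It is a known fact that such a point exists and is unique for every $x$, so $CC_{\mathcal{S}}:\mathcal{H}\to\mathcal{H}$ is well defined. *)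

theory Defs
  imports "HOL-Analysis.Analysis"
begin

definition Fix :: "('a \<Rightarrow> 'a) \<Rightarrow> 'a set"
  where "Fix G = {x. G x = x}"

definition affine_map :: "('a::real_vector \<Rightarrow> 'b::real_vector) \<Rightarrow> bool"
  where "affine_map T \<longleftrightarrow>
    (\<forall>x y u v. u + v = 1 \<longrightarrow> T (u *\<^sub>R x + v *\<^sub>R y) = u *\<^sub>R T x + v *\<^sub>R T y)"

definition isometry :: "('a::real_normed_vector \<Rightarrow> 'b::real_normed_vector) \<Rightarrow> bool"
  where "isometry T \<longleftrightarrow> (\<forall>x y. norm (T x - T y) = norm (x - y))"

text \<open>The metric projection onto a nonempty closed convex set is the library's
  \<^const>\<open>closest_point\<close>.\<close>

definition is_BAM_with :: "real \<Rightarrow> ('a::euclidean_space \<Rightarrow> 'a) \<Rightarrow> bool"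
  where "is_BAM_with \<gamma> G \<longleftrightarrow>
    0 \<le> \<gamma> \<and> \<gamma> < 1 \<and>
    Fix G \<noteq> {} \<and> closed (Fix G) \<and> convex (Fix G) \<and>
    closest_point (Fix G) \<circ> G = closest_point (Fix G) \<and>
    (\<forall>x. norm (G x - closest_point (Fix G) x) \<le> \<gamma> * norm (x - closest_point (Fix G) x))"

definition is_BAM :: "('a::euclidean_space \<Rightarrow> 'a) \<Rightarrow> bool"
  where "is_BAM G \<longleftrightarrow> (\<exists>\<gamma>. is_BAM_with \<gamma> G)"

text \<open>The description below determines a point for every \<open>x\<close> when \<open>S\<close> is a nonempty finite set of
  affine isometries with a common fixed point; otherwise the value may be unspecified.\<close>

definition CC :: "('a::euclidean_space \<Rightarrow> 'a) set \<Rightarrow> 'a \<Rightarrow> 'a"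
  where "CC S x = (THE p. p \<in> affine hull ((\<lambda>T. T x) ` S) \<and>
                          is_singleton ((\<lambda>T. norm (p - T x)) ` S))"

text \<open>\<open>op_prod T a j\<close> is \<open>T (a + j) \<circ> \<dots> \<circ> T (a + 2) \<circ> T (a + 1)\<close>.\<close>

primrec op_prod :: "(nat \<Rightarrow> 'a \<Rightarrow> 'a) \<Rightarrow> nat \<Rightarrow> nat \<Rightarrow> 'a \<Rightarrow> 'a"
  where
    "op_prod T a 0 = id"
  | "op_prod T a (Suc j) = T (a + Suc j) \<circ> op_prod T a j"

text \<open>Used for \<open>i \<ge> 1\<close> and \<open>q (i - 1) \<le> q i\<close> only, so that neither subtraction truncates.\<close>

definition block :: "(nat \<Rightarrow> 'a \<Rightarrow> 'a) \<Rightarrow> (nat \<Rightarrow> nat) \<Rightarrow> nat \<Rightarrow> ('a \<Rightarrow> 'a) set"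
  where "block T q i = op_prod T (q (i - 1)) ` {0..q i - q (i - 1)}"

end

theory Submission
  imports Defs
begin

text \<open>A circumcenter \<open>p = CC S x\<close> is the projection of every common fixed point \<open>z\<close> onto the affine
  hull of the orbit \<open>S(x)\<close>. As \<open>x\<close> itself lies in \<open>S(x)\<close>, Pythagoras gives
  \<open>\<parallel>p - z\<parallel>\<^sup>2 = \<parallel>x - z\<parallel>\<^sup>2 - \<parallel>p - x\<parallel>\<^sup>2\<close>, and equidistance gives \<open>\<parallel>T x - x\<parallel> \<le> 2 \<parallel>p - x\<parallel>\<close> for all
  \<open>T\<close> in \<open>S\<close>. A compactness argument bounds the distance from \<open>x\<close> to the common fixed set \<open>W\<close> by a
  multiple of the sum of the \<open>\<parallel>T x - x\<parallel>\<close>, so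
  \<open>\<parallel>p - z\<parallel>\<^sup>2 \<le> \<parallel>x - z\<parallel>\<^sup>2 - c d(x, W)\<^sup>2\<close> with \<open>c > 0\<close> for all \<open>z\<close> in \<open>W\<close>. By linear regularity of affine
  subspaces this inequality is inherited by compositions and convex combinations, with \<open>W\<close> replaced by
  the intersection; and for affine \<open>W\<close> it implies that the map is a BAM with fixed set \<open>W\<close>.\<close>

section \<open>Affine subspaces: projections, distances and error bounds\<close>

lemma affine_shift_mem:
  fixes W :: "'a::real_vector set"
  assumes "affine W" "z \<in> W" "x \<in> W" "p \<in> W"
  shows "z + a *\<^sub>R (x - p) \<in> W"
proof -
  have "x - p \<in> (\<lambda>y. (-p) + y) ` W"
    using \<open>x \<in> W\<close> by force
  moreover have "subspace ((\<lambda>y. (-p) + y) ` W)"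
    using affine_diffs_subspace assms by blast
  ultimately have "a *\<^sub>R (x - p) + (z - p) \<in> (\<lambda>y. (-p) + y) ` W"
    using \<open>z \<in> W\<close> by (intro subspace_add subspace_scale) force+
  then show ?thesis
    by (force simp: algebra_simps)
qed

text \<open>The projection \<open>p\<close> may be moved by \<open>w - v\<close> in either direction
  without leaving \<open>W\<close>, so the variational inequality of the projection holds with both
  signs.\<close>

lemma closest_point_affine_orthogonal:
  fixes W :: "'a::euclidean_space set"
  assumes "affine W" "w \<in> W" "v \<in> W"
  shows "(x - closest_point W x) \<bullet> (w - v) = 0"
proof -
  let ?p = "closest_point W x"
  have W: "convex W" "closed W"
    using assms by (auto intro: affine_imp_convex affine_closed)
  have p: "?p \<in> W"
    using closest_point_in_set W assms by blast
  have "(x - ?p) \<bullet> ((?p + 1 *\<^sub>R (w - v)) - ?p) \<le> 0"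
    by (rule closest_point_dot[OF W]) (rule affine_shift_mem[OF assms(1) p assms(2,3)])
  moreover have "(x - ?p) \<bullet> ((?p + 1 *\<^sub>R (v - w)) - ?p) \<le> 0"
    by (rule closest_point_dot[OF W]) (rule affine_shift_mem[OF assms(1) p assms(3,2)])
  ultimately show ?thesis
    by (simp add: inner_diff_right)
qed

lemma infdist_eq_norm_closest_point:
  fixes W :: "'a::euclidean_space set"
  assumes "affine W" "W \<noteq> {}"
  shows "infdist x W = norm (x - closest_point W x)"
  using assms affine_closed[of W]
  by (simp add: infdist_eq_setdist setdist_closest_point dist_norm)

lemma closest_point_affine_Pythagoras:
  fixes W :: "'a::euclidean_space set"
  assumes "affine W" "w \<in> W"
  shows "(norm (x - w))\<^sup>2 = (norm (x - closest_point W x))\<^sup>2 + (norm (closest_point W x - w))\<^sup>2"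
proof -
  let ?p = "closest_point W x"
  have "?p \<in> W"
    using closest_point_in_set affine_closed assms by blast
  then have "(x - ?p) \<bullet> (?p - w) = 0"
    using closest_point_affine_orthogonal assms by blast
  then have "(norm ((x - ?p) + (?p - w)))\<^sup>2 = (norm (x - ?p))\<^sup>2 + (norm (?p - w))\<^sup>2"
    using norm_add_Pythagorean unfolding orthogonal_def by blast
  then show ?thesis by simp
qed

text \<open>After normalising by homogeneity, it suffices that \<open>f\<close> attains a positive minimum on the unit sphere
  of the orthogonal complement of \<open>W\<close> at \<open>z\<close>.\<close>

lemma affine_homogeneous_error_bound:
  fixes W :: "'a::euclidean_space set" and f :: "'a \<Rightarrow> real"
  assumes W: "affine W" "z \<in> W"
    and f: "continuous_on UNIV f" "\<And>x. 0 \<le> f x" "\<And>x. f x = 0 \<Longrightarrow> x \<in> W"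
    and hom: "\<And>a x p. p \<in> W \<Longrightarrow> f (z + a *\<^sub>R (x - p)) = \<bar>a\<bar> * f x"
  shows "\<exists>\<kappa>>0. \<forall>x. infdist x W \<le> \<kappa> * f x"
proof -
  \<comment> \<open>The unit sphere about \<open>z\<close> in the directions orthogonal to
    \<open>W\<close>. Normalising \<open>x - closest_point W x\<close> for \<open>x\<close> outside
    \<open>W\<close> gives a point of it.\<close>
  define K where "K = sphere z 1 \<inter> (\<Inter>w\<in>W. {y. (y - z) \<bullet> (w - z) = 0})"
  have "closed {y. (y - z) \<bullet> (w - z) = 0}" for w
    by (intro closed_Collect_eq continuous_intros)
  then have "compact K"
    unfolding K_def by (intro compact_Int_closed closed_INT) auto
  have clW: "closed W" using W affine_closed by blast
  have scaled: "z + (1 / norm (x - closest_point W x)) *\<^sub>R (x - closest_point W x) \<in> K"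
    if "x \<notin> W" for x
  proof -
    have "x \<noteq> closest_point W x"
      using that W clW closest_point_in_set by (metis empty_iff)
    then show ?thesis
      unfolding K_def using closest_point_affine_orthogonal[OF W(1) _ W(2), of _ x]
      by (auto simp: dist_norm)
  qed
  \<comment> \<open>Homogeneity with \<open>p = x\<close>: the factor 0 gives
    \<open>f z = 0\<close>, and the factor 1 gives \<open>f z = f x\<close>.\<close>
  have fW: "f x = 0" if "x \<in> W" for x
    using hom[of x 0 x] hom[of x 1 x] that by simp
  show ?thesis
  proof (cases "K = {}")
    case True
    \<comment> \<open>Without a unit vector orthogonal to \<open>W\<close>, the subspace
      \<open>W\<close> is the whole space and any positive constant works.\<close>
    then have "x \<in> W" for x using scaled by blast
    then show ?thesis using f(2) by (intro exI[of _ 1]) auto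
  next
    case False
    obtain y where y: "y \<in> K" "\<And>u. u \<in> K \<Longrightarrow> f y \<le> f u"
      using continuous_attains_inf[OF \<open>compact K\<close> False] continuous_on_subset[OF f(1)] by blast
    \<comment> \<open>A zero of \<open>f\<close> lies in \<open>W\<close>, so \<open>y - z\<close>
      would be orthogonal to itself although it has norm 1.\<close>
    have "f y \<noteq> 0"
    proof
      assume "f y = 0"
      then have "(y - z) \<bullet> (y - z) = 0"
        using f(3) y(1) unfolding K_def by blast
      then show False using y(1) by (simp add: K_def)
    qed
    then have pos: "f y > 0" using f(2)[of y] by simp
    have "infdist x W \<le> (1 / f y) * f x" for x
    proof (cases "x \<in> W")
      case True
      then show ?thesis using fW by simp
    next
      case False
      let ?p = "closest_point W x"
      have p: "?p \<in> W" using W clW closest_point_in_set by blast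
      then have n: "norm (x - ?p) > 0" using False by auto
      have "f y \<le> f (z + (1 / norm (x - ?p)) *\<^sub>R (x - ?p))"
        using y(2) scaled[OF False] by blast
      also have "\<dots> = f x / norm (x - ?p)"
        using hom[OF p] by simp
      finally have "norm (x - ?p) \<le> f x / f y"
        using n pos by (simp add: field_simps)
      then show ?thesis
        using infdist_eq_norm_closest_point[OF W(1), of x] W(2) by force
    qed
    then show ?thesis using pos by (intro exI[of _ "1 / f y"]) auto
  qed
qed

text \<open>Applying the shift to the nearest point of \<open>W\<close> bounds the left side from
  above. The inverse shift has factor \<open>1 / a\<close> and exchanges the roles of
  \<open>z\<close> and \<open>p\<close>, so the same bound yields the converse for nonzero
  \<open>a\<close>.\<close>

lemma infdist_affine_shift:
  fixes W :: "'a::euclidean_space set"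
  assumes W: "affine W" "z \<in> W" "p \<in> W"
  shows "infdist (z + a *\<^sub>R (x - p)) W = \<bar>a\<bar> * infdist x W"
proof -
  have le: "infdist (z + a *\<^sub>R (x - p)) W \<le> \<bar>a\<bar> * infdist x W"
    if "z \<in> W" "p \<in> W" for z p x :: 'a and a
  proof -
    let ?q = "closest_point W x"
    have "?q \<in> W" using closest_point_in_set affine_closed W by blast
    then have "z + a *\<^sub>R (?q - p) \<in> W"
      using affine_shift_mem W(1) that by blast
    then have "infdist (z + a *\<^sub>R (x - p)) W \<le> norm ((z + a *\<^sub>R (x - p)) - (z + a *\<^sub>R (?q - p)))"
      unfolding dist_norm[symmetric] by (rule infdist_le)
    also have "\<dots> = norm (a *\<^sub>R (x - ?q))" by (simp add: algebra_simps)
    finally show ?thesis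
      using infdist_eq_norm_closest_point[OF W(1), of x] W(2) by force
  qed
  show ?thesis
  proof (cases "a = 0")
    case True
    then show ?thesis using W by simp
  next
    case False
    have "infdist x W \<le> \<bar>1 / a\<bar> * infdist (z + a *\<^sub>R (x - p)) W"
      using le[OF W(3,2), of "1 / a" "z + a *\<^sub>R (x - p)"] False by simp
    then have "\<bar>a\<bar> * infdist x W \<le> infdist (z + a *\<^sub>R (x - p)) W"
      using False by (simp add: abs_divide field_simps)
    then show ?thesis using le[OF W(2,3), of a x] by simp
  qed
qed

text \<open>Linear regularity: the sum of the distances is homogeneous by
  \<open>infdist_affine_shift\<close> and vanishes only on the intersection, so the compactness
  bound applies to it.\<close>

lemma affine_family_regular:
  fixes W :: "'i \<Rightarrow> 'a::euclidean_space set"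
  assumes "finite I" "\<And>i. i \<in> I \<Longrightarrow> affine (W i)" "(\<Inter>i\<in>I. W i) \<noteq> {}"
  shows "\<exists>\<kappa>>0. \<forall>x. infdist x (\<Inter>i\<in>I. W i) \<le> \<kappa> * (\<Sum>i\<in>I. infdist x (W i))"
proof -
  obtain z where z: "z \<in> (\<Inter>i\<in>I. W i)" using assms by blast
  show ?thesis
  proof (rule affine_homogeneous_error_bound[OF _ z])
    show "affine (\<Inter>i\<in>I. W i)" using assms by (intro affine_Inter) auto
    show "continuous_on UNIV (\<lambda>x. \<Sum>i\<in>I. infdist x (W i))"
      by (intro continuous_intros)
    show "0 \<le> (\<Sum>i\<in>I. infdist x (W i))" for x
      by (intro sum_nonneg infdist_nonneg)
    show "x \<in> (\<Inter>i\<in>I. W i)" if "(\<Sum>i\<in>I. infdist x (W i)) = 0" for x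
    proof
      fix i assume i: "i \<in> I"
      then have "infdist x (W i) = 0"
        using that assms(1) by (simp add: sum_nonneg_eq_0_iff infdist_nonneg)
      moreover have "closed (W i)" "W i \<noteq> {}"
        using assms(2) i z affine_closed by auto
      ultimately show "x \<in> W i" using in_closed_iff_infdist_zero by blast
    qed
    show "(\<Sum>i\<in>I. infdist (z + a *\<^sub>R (x - p)) (W i)) = \<bar>a\<bar> * (\<Sum>i\<in>I. infdist x (W i))"
      if "p \<in> (\<Inter>i\<in>I. W i)" for a x p
      unfolding sum_distrib_left using that z assms
      by (intro sum.cong infdist_affine_shift) auto
  qed
qed

section \<open>Affine isometries and their fixed points\<close>

lemma affine_map_shift:
  assumes "affine_map T" "T z = z" "T p = p"
  shows "T (z + a *\<^sub>R (x - p)) = z + a *\<^sub>R (T x - p)"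
proof -
  have T: "T (u *\<^sub>R x + v *\<^sub>R y) = u *\<^sub>R T x + v *\<^sub>R T y" if "u + v = 1" for u v x y
    using assms(1) that unfolding affine_map_def by blast
  \<comment> \<open>Affinity is available for two points at a time, so
    \<open>z + a *\<^sub>R (x - p) = ?y + z - p\<close> is built in three stages: \<open>?y\<close>,
    the midpoint \<open>?h\<close> of \<open>?y\<close> and \<open>z\<close>, and finally the
    combination of \<open>?h\<close> and \<open>p\<close> with weights 2 and -1.\<close>
  let ?y = "(1 - a) *\<^sub>R p + a *\<^sub>R x"
  let ?h = "(1/2) *\<^sub>R ?y + (1/2) *\<^sub>R z"
  have y: "T ?y = (1 - a) *\<^sub>R p + a *\<^sub>R T x" using T[of "1 - a" a p x] assms by simp
  have h: "T ?h = (1/2) *\<^sub>R T ?y + (1/2) *\<^sub>R z" using T[of "1/2" "1/2" ?y z] assms by simp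
  have "T (2 *\<^sub>R ?h + (-1) *\<^sub>R p) = 2 *\<^sub>R T ?h + (-1) *\<^sub>R p"
    using T[of 2 "-1" ?h p] assms by simp
  moreover have "2 *\<^sub>R ?h + (-1) *\<^sub>R p = z + a *\<^sub>R (x - p)"
    by (simp add: scaleR_add_right algebra_simps)
  ultimately show ?thesis unfolding h y by (simp add: algebra_simps)
qed

lemma affine_Fix:
  assumes "affine_map T"
  shows "affine (Fix T)"
  using assms unfolding affine_def affine_map_def Fix_def by simp

lemma continuous_on_isometry:
  assumes "isometry T"
  shows "continuous_on A T"
  unfolding continuous_on_iff
proof (intro ballI allI impI)
  fix x and e :: real assume "e > 0"
  then show "\<exists>d>0. \<forall>x'\<in>A. dist x' x < d \<longrightarrow> dist (T x') (T x) < e"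
    using assms by (intro exI[of _ e]) (simp add: isometry_def dist_norm)
qed

text \<open>By \<open>affine_map_shift\<close> each residual \<open>T x - x\<close> is multiplied by
  \<open>a\<close> under the shift, and the sum of the residual norms vanishes only at common fixed
  points.\<close>

lemma affine_isometries_error_bound:
  fixes S :: "('a::euclidean_space \<Rightarrow> 'a) set"
  assumes "finite S" and S: "\<And>T. T \<in> S \<Longrightarrow> affine_map T \<and> isometry T"
    and "(\<Inter>T\<in>S. Fix T) \<noteq> {}"
  shows "\<exists>\<kappa>>0. \<forall>x. infdist x (\<Inter>T\<in>S. Fix T) \<le> \<kappa> * (\<Sum>T\<in>S. norm (T x - x))"
proof -
  obtain z where z: "z \<in> (\<Inter>T\<in>S. Fix T)" using assms by blast
  show ?thesis
  proof (rule affine_homogeneous_error_bound[OF _ z])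
    show "affine (\<Inter>T\<in>S. Fix T)" using S affine_Fix by (intro affine_Inter) auto
    show "continuous_on UNIV (\<lambda>x. \<Sum>T\<in>S. norm (T x - x))"
      using S by (intro continuous_intros continuous_on_isometry) auto
    show "0 \<le> (\<Sum>T\<in>S. norm (T x - x))" for x
      by (intro sum_nonneg) auto
    show "x \<in> (\<Inter>T\<in>S. Fix T)" if "(\<Sum>T\<in>S. norm (T x - x)) = 0" for x
      using that assms(1) by (auto simp: sum_nonneg_eq_0_iff Fix_def)
    show "(\<Sum>T\<in>S. norm (T (z + a *\<^sub>R (x - p)) - (z + a *\<^sub>R (x - p)))) =
        \<bar>a\<bar> * (\<Sum>T\<in>S. norm (T x - x))"
      if "p \<in> (\<Inter>T\<in>S. Fix T)" for a x p
      unfolding sum_distrib_left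
    proof (intro sum.cong refl)
      fix T assume "T \<in> S"
      then have "T (z + a *\<^sub>R (x - p)) = z + a *\<^sub>R (T x - p)"
        using S that z by (intro affine_map_shift) (auto simp: Fix_def)
      then have "T (z + a *\<^sub>R (x - p)) - (z + a *\<^sub>R (x - p)) = a *\<^sub>R (T x - x)"
        by (simp add: algebra_simps)
      then show "norm (T (z + a *\<^sub>R (x - p)) - (z + a *\<^sub>R (x - p))) = \<bar>a\<bar> * norm (T x - x)"
        by simp
    qed
  qed
qed

section \<open>Circumcenters as projections of common fixed points\<close>

lemma equidistant_point_unique:
  fixes A :: "'a::real_inner set"
  assumes p: "p \<in> affine hull A" "\<And>a b. a \<in> A \<Longrightarrow> b \<in> A \<Longrightarrow> norm (p - a) = norm (p - b)"
    and p': "p' \<in> affine hull A" "\<And>a b. a \<in> A \<Longrightarrow> b \<in> A \<Longrightarrow> norm (p' - a) = norm (p' - b)"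
  shows "p = p'"
proof -
  obtain b where b: "b \<in> A" using p(1) by fastforce
  \<comment> \<open>Subtracting the squared equidistance relations of \<open>p\<close> and
    \<open>p'\<close> cancels the terms quadratic in \<open>a\<close>. What remains puts
    \<open>A\<close>, hence its affine hull with \<open>p\<close> and \<open>p'\<close>, into one
    hyperplane orthogonal to \<open>p - p'\<close>.\<close>
  have "(p - p') \<bullet> a = (p - p') \<bullet> b" if "a \<in> A" for a
    using p(2)[OF that b] p'(2)[OF that b]
    by (simp add: norm_eq inner_diff inner_commute algebra_simps)
  then have "A \<subseteq> {a. (p - p') \<bullet> a = (p - p') \<bullet> b}" by blast
  then have sub: "affine hull A \<subseteq> {a. (p - p') \<bullet> a = (p - p') \<bullet> b}"
    by (rule hull_minimal) (rule affine_hyperplane)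
  have "(p - p') \<bullet> p = (p - p') \<bullet> p'"
    using subsetD[OF sub p(1)] subsetD[OF sub p'(1)] by simp
  then have "(p - p') \<bullet> (p - p') = 0" by (simp add: inner_diff_right)
  then show ?thesis by simp
qed

text \<open>Each \<open>T x\<close> has the same distance to \<open>z\<close>, namely
  \<open>norm (z - x)\<close>, since \<open>T\<close> is an isometry fixing \<open>z\<close>. By
  Pythagoras the projection of \<open>z\<close> onto the hull is then equidistant from all
  \<open>T x\<close>, and uniqueness identifies it with the circumcenter.\<close>

lemma CC_eq_closest_point:
  fixes S :: "('a::euclidean_space \<Rightarrow> 'a) set"
  assumes "S \<noteq> {}" "\<And>T. T \<in> S \<Longrightarrow> isometry T" "z \<in> (\<Inter>T\<in>S. Fix T)"
  shows "CC S x = closest_point (affine hull ((\<lambda>T. T x) ` S)) z"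
    and "T \<in> S \<Longrightarrow> T' \<in> S \<Longrightarrow> norm (CC S x - T x) = norm (CC S x - T' x)"
proof -
  let ?A = "affine hull ((\<lambda>T. T x) ` S)"
  let ?p = "closest_point ?A z"
  have p: "?p \<in> ?A"
    using assms(1) by (intro closest_point_in_set affine_closed) auto
  have eq: "norm (?p - T x) = norm (?p - T' x)" if "T \<in> S" "T' \<in> S" for T T'
  proof -
    have "(norm (?p - T x))\<^sup>2 = (norm (z - x))\<^sup>2 - (norm (z - ?p))\<^sup>2" if "T \<in> S" for T
    proof -
      have "T z = z" using that assms(3) by (auto simp: Fix_def)
      then have "norm (z - T x) = norm (T z - T x)" by simp
      also have "\<dots> = norm (z - x)" using that assms(2) unfolding isometry_def by blast
      finally show ?thesis
        using closest_point_affine_Pythagoras[of ?A "T x" z] that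
        by (simp add: hull_inc)
    qed
    then show ?thesis using that by (metis norm_ge_zero power2_eq_iff_nonneg)
  qed
  have sing: "is_singleton ((\<lambda>T. norm (r - T x)) ` S) \<longleftrightarrow>
      (\<forall>T\<in>S. \<forall>T'\<in>S. norm (r - T x) = norm (r - T' x))" for r
  proof
    assume "is_singleton ((\<lambda>T. norm (r - T x)) ` S)"
    then obtain d where "(\<lambda>T. norm (r - T x)) ` S = {d}" by (rule is_singletonE)
    then have "norm (r - T x) = d" if "T \<in> S" for T using that by blast
    then show "\<forall>T\<in>S. \<forall>T'\<in>S. norm (r - T x) = norm (r - T' x)" by simp
  next
    assume *: "\<forall>T\<in>S. \<forall>T'\<in>S. norm (r - T x) = norm (r - T' x)"
    obtain T where T: "T \<in> S" using assms(1) by blast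
    have "(\<lambda>T. norm (r - T x)) ` S = (\<lambda>_. norm (r - T x)) ` S"
      by (rule image_cong[OF refl]) (use * T in blast)
    then have "(\<lambda>T. norm (r - T x)) ` S = {norm (r - T x)}" using T by (simp only: image_constant)
    then show "is_singleton ((\<lambda>T. norm (r - T x)) ` S)" by (simp add: is_singleton_def)
  qed
  show CC: "CC S x = ?p"
    unfolding CC_def
  proof (rule the_equality)
    show "?p \<in> ?A \<and> is_singleton ((\<lambda>T. norm (?p - T x)) ` S)"
      using p eq sing by blast
    show "r = ?p" if "r \<in> ?A \<and> is_singleton ((\<lambda>T. norm (r - T x)) ` S)" for r
      using that p eq sing by (intro equidistant_point_unique[of _ "(\<lambda>T. T x) ` S"]) auto
  qed
  show "norm (CC S x - T x) = norm (CC S x - T' x)" if "T \<in> S" "T' \<in> S"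
    unfolding CC using that by (rule eq)
qed

section \<open>The attraction inequality, its validity for circumcenter mappings and its
  stability\<close>

definition attracts :: "('a::real_normed_vector \<Rightarrow> 'a) \<Rightarrow> 'a set \<Rightarrow> bool"
  where "attracts H W \<longleftrightarrow>
    (\<exists>c>0. \<forall>x. \<forall>z\<in>W. (norm (H x - z))\<^sup>2 \<le> (norm (x - z))\<^sup>2 - c * (infdist x W)\<^sup>2)"

text \<open>Shrinking the constant to at most 1 keeps \<open>1 - c\<close> nonnegative, so that
  \<open>sqrt (1 - c)\<close> can serve as a contraction factor.\<close>

lemma attractsE:
  assumes "attracts H W"
  obtains c where "c > 0" "c \<le> 1"
    "\<And>x z. z \<in> W \<Longrightarrow> (norm (H x - z))\<^sup>2 \<le> (norm (x - z))\<^sup>2 - c * (infdist x W)\<^sup>2"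
proof -
  obtain c where c: "c > 0"
    "\<And>x z. z \<in> W \<Longrightarrow> (norm (H x - z))\<^sup>2 \<le> (norm (x - z))\<^sup>2 - c * (infdist x W)\<^sup>2"
    using assms unfolding attracts_def by blast
  have "min c 1 * (infdist x W)\<^sup>2 \<le> c * (infdist x W)\<^sup>2" for x
    by (intro mult_right_mono) auto
  then show ?thesis
    using c by (intro that[of "min c 1"]) (auto intro: order_trans[OF c(2)])
qed

lemma attracts_nonexpansive:
  assumes "attracts H W" "z \<in> W"
  shows "norm (H x - z) \<le> norm (x - z)"
proof -
  obtain c where "c > 0" "(norm (H x - z))\<^sup>2 \<le> (norm (x - z))\<^sup>2 - c * (infdist x W)\<^sup>2"
    using assms unfolding attracts_def by blast
  then have "(norm (H x - z))\<^sup>2 \<le> (norm (x - z))\<^sup>2"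
    by (smt (verit) mult_nonneg_nonneg zero_le_power2)
  then show ?thesis by (simp add: power2_le_iff_abs_le)
qed

lemma attracts_CC:
  fixes S :: "('a::euclidean_space \<Rightarrow> 'a) set"
  assumes "finite S" and S: "\<And>T. T \<in> S \<Longrightarrow> affine_map T \<and> isometry T"
    and ne: "(\<Inter>T\<in>S. Fix T) \<noteq> {}" and id: "id \<in> S"
  shows "attracts (CC S) (\<Inter>T\<in>S. Fix T)"
proof -
  let ?W = "\<Inter>T\<in>S. Fix T"
  obtain \<kappa> where \<kappa>: "\<kappa> > 0" "\<And>x. infdist x ?W \<le> \<kappa> * (\<Sum>T\<in>S. norm (T x - x))"
    using affine_isometries_error_bound[OF assms(1) S ne] by blast
  \<comment> \<open>Each of the \<open>card S\<close> residuals is at most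
    \<open>2 * norm (CC S x - x)\<close>, so the error bound becomes
    \<open>infdist x ?W \<le> M * norm (CC S x - x)\<close>.\<close>
  define M where "M = \<kappa> * (2 * real (card S))"
  have "card S > 0" using id assms(1) by (auto simp: card_gt_0_iff)
  then have M: "M > 0" using \<kappa>(1) by (simp add: M_def)
  have "(norm (CC S x - z))\<^sup>2 \<le> (norm (x - z))\<^sup>2 - 1 / M\<^sup>2 * (infdist x ?W)\<^sup>2" if z: "z \<in> ?W" for x z
  proof -
    let ?p = "CC S x" and ?A = "affine hull ((\<lambda>T. T x) ` S)"
    have S0: "S \<noteq> {}" "\<And>T. T \<in> S \<Longrightarrow> isometry T" using id S by auto
    have cc: "?p = closest_point ?A z"
      by (rule CC_eq_closest_point(1)) (use S0 z in auto)
    have eqd: "norm (?p - T x) = norm (?p - x)" if "T \<in> S" for T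
    proof -
      have "norm (?p - T x) = norm (?p - id x)"
        using CC_eq_closest_point(2)[OF S0(1) _ z that id] S0(2) by blast
      then show ?thesis by simp
    qed
    have "norm (T x - x) \<le> 2 * norm (?p - x)" if "T \<in> S" for T
    proof -
      have "norm (T x - x) \<le> norm (?p - x) + norm (?p - T x)"
        using norm_triangle_ineq4[of "?p - x" "?p - T x"] by simp
      then show ?thesis using eqd[OF that] by simp
    qed
    then have "(\<Sum>T\<in>S. norm (T x - x)) \<le> of_nat (card S) * (2 * norm (?p - x))"
      by (rule sum_bounded_above)
    then have "infdist x ?W \<le> M * norm (?p - x)"
      using \<kappa> order_trans[OF \<kappa>(2)] by (simp add: M_def mult.assoc)
    then have "(infdist x ?W)\<^sup>2 \<le> M\<^sup>2 * (norm (?p - x))\<^sup>2"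
      unfolding power_mult_distrib[symmetric] using infdist_nonneg by (rule power_mono)
    then have "1 / M\<^sup>2 * (infdist x ?W)\<^sup>2 \<le> (norm (?p - x))\<^sup>2"
      using M by (simp add: field_simps)
    moreover have "x \<in> ?A" using imageI[OF id, of "\<lambda>T. T x"] by (simp add: hull_inc)
    then have "(norm (z - x))\<^sup>2 = (norm (z - ?p))\<^sup>2 + (norm (?p - x))\<^sup>2"
      unfolding cc by (intro closest_point_affine_Pythagoras) auto
    ultimately show ?thesis by (simp add: norm_minus_commute)
  qed
  then show ?thesis unfolding attracts_def using M by (intro exI[of _ "1 / M\<^sup>2"]) auto
qed

text \<open>The decreases of the two steps add up, but the second one involves the distance to
  \<open>W2\<close> from \<open>H1 x\<close> rather than from \<open>x\<close>. Since
  \<open>H1\<close> moves \<open>x\<close> by at most twice its distance to \<open>W1\<close>, both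
  decreases together control the distances from \<open>x\<close> to both sets, and linear regularity
  passes to the intersection.\<close>

lemma attracts_compose:
  fixes W1 W2 :: "'a::euclidean_space set"
  assumes H: "attracts H1 W1" "attracts H2 W2"
    and W: "affine W1" "affine W2" "W1 \<inter> W2 \<noteq> {}"
  shows "attracts (H2 \<circ> H1) (W1 \<inter> W2)"
proof -
  obtain c1 where c1: "c1 > 0"
    "\<And>x z. z \<in> W1 \<Longrightarrow> (norm (H1 x - z))\<^sup>2 \<le> (norm (x - z))\<^sup>2 - c1 * (infdist x W1)\<^sup>2"
    using attractsE[OF H(1)] by metis
  obtain c2 where c2: "c2 > 0"
    "\<And>x z. z \<in> W2 \<Longrightarrow> (norm (H2 x - z))\<^sup>2 \<le> (norm (x - z))\<^sup>2 - c2 * (infdist x W2)\<^sup>2"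
    using attractsE[OF H(2)] by metis
  define c where "c = min c1 c2"
  have c: "c > 0" "c \<le> c1" "c \<le> c2" using c1 c2 by (auto simp: c_def)
  obtain \<kappa> where \<kappa>: "\<kappa> > 0"
    "\<And>x. infdist x (W1 \<inter> W2) \<le> \<kappa> * (infdist x W1 + infdist x W2)"
  proof -
    \<comment> \<open>Linear regularity of two sets, viewed as a family indexed by the
      Booleans.\<close>
    let ?V = "\<lambda>b. if b then W1 else W2"
    have eq: "(\<Inter>b\<in>UNIV. ?V b) = W1 \<inter> W2" by (auto simp: UNIV_bool)
    have "affine (?V b)" for b using W by simp
    then have "\<exists>\<kappa>>0. \<forall>x. infdist x (\<Inter>b\<in>UNIV. ?V b) \<le> \<kappa> * (\<Sum>b\<in>UNIV. infdist x (?V b))"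
      using W(3) eq by (intro affine_family_regular) (auto simp only: finite)
    then show ?thesis unfolding eq using that by (auto simp: UNIV_bool add.commute)
  qed
  have "(norm ((H2 \<circ> H1) x - z))\<^sup>2 \<le> (norm (x - z))\<^sup>2 - c / (10 * \<kappa>\<^sup>2) * (infdist x (W1 \<inter> W2))\<^sup>2"
    if z: "z \<in> W1 \<inter> W2" for x z
  proof -
    define d e where "d = infdist x W1" and "e = infdist (H1 x) W2"
    let ?p = "closest_point W1 x"
    have p: "?p \<in> W1" using W closest_point_in_set affine_closed by blast
    have "norm (x - H1 x) \<le> norm (x - ?p) + norm (H1 x - ?p)"
      using norm_triangle_ineq4[of "x - ?p" "H1 x - ?p"] by simp
    also have "\<dots> \<le> 2 * d"
    proof -
      have "W1 \<noteq> {}" using W(3) by blast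
      then show ?thesis
        using attracts_nonexpansive[OF H(1) p, of x] infdist_eq_norm_closest_point[OF W(1), of x]
        by (simp add: d_def)
    qed
    finally have "dist x (H1 x) \<le> 2 * d" by (simp add: dist_norm)
    then have "infdist x W2 \<le> e + 2 * d"
      using infdist_triangle[of x W2 "H1 x"] by (simp add: e_def)
    then have "\<kappa> * (d + infdist x W2) \<le> \<kappa> * (3 * d + e)"
      using \<kappa>(1) by (intro mult_left_mono) auto
    then have "infdist x (W1 \<inter> W2) \<le> \<kappa> * (3 * d + e)"
      using \<kappa>(2)[of x] by (simp add: d_def)
    then have "(infdist x (W1 \<inter> W2))\<^sup>2 \<le> \<kappa>\<^sup>2 * (3 * d + e)\<^sup>2"
      unfolding power_mult_distrib[symmetric] using infdist_nonneg by (rule power_mono)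
    \<comment> \<open>Cauchy-Schwarz with the factor 10 = 9 + 1; the difference of the two sides is
      the square of \<open>d - 3 * e\<close>.\<close>
    also have "(3 * d + e)\<^sup>2 \<le> 10 * (d\<^sup>2 + e\<^sup>2)"
      using zero_le_power2[of "d - 3 * e"] by (simp add: power2_eq_square algebra_simps)
    finally have "(infdist x (W1 \<inter> W2))\<^sup>2 \<le> \<kappa>\<^sup>2 * (10 * (d\<^sup>2 + e\<^sup>2))"
      using \<kappa>(1) by (simp add: mult_left_mono)
    then have "(infdist x (W1 \<inter> W2))\<^sup>2 / (10 * \<kappa>\<^sup>2) \<le> d\<^sup>2 + e\<^sup>2"
      using \<kappa>(1) by (simp add: field_simps)
    then have "c * ((infdist x (W1 \<inter> W2))\<^sup>2 / (10 * \<kappa>\<^sup>2)) \<le> c * (d\<^sup>2 + e\<^sup>2)"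
      using c by (intro mult_left_mono) auto
    also have "\<dots> \<le> c1 * d\<^sup>2 + c2 * e\<^sup>2"
      unfolding distrib_left using c by (intro add_mono mult_right_mono) auto
    finally show ?thesis
      using c1(2)[of z x] c2(2)[of z "H1 x"] z by (simp add: d_def e_def)
  qed
  then show ?thesis
    unfolding attracts_def using c \<kappa> by (intro exI[of _ "c / (10 * \<kappa>\<^sup>2)"]) auto
qed

lemma attracts_op_prod:
  fixes W :: "nat \<Rightarrow> 'a::euclidean_space set"
  assumes "\<And>i. i \<in> {1..t} \<Longrightarrow> attracts (H i) (W i)" "\<And>i. i \<in> {1..t} \<Longrightarrow> affine (W i)"
    and "(\<Inter>i\<in>{1..t}. W i) \<noteq> {}"
  shows "attracts (op_prod H 0 t) (\<Inter>i\<in>{1..t}. W i)"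
  using assms
proof (induction t)
  case 0
  \<comment> \<open>The empty intersection is the whole space, where the decrease term vanishes, so
    the identity satisfies the inequality with \<open>c = 1\<close>.\<close>
  have "infdist x UNIV = 0" for x :: 'a by simp
  then show ?case by (auto simp: attracts_def intro: exI[of _ 1])
next
  case (Suc t)
  have eq: "(\<Inter>i\<in>{1..Suc t}. W i) = (\<Inter>i\<in>{1..t}. W i) \<inter> W (Suc t)"
    by (auto simp: atLeastAtMostSuc_conv)
  then have ne: "(\<Inter>i\<in>{1..t}. W i) \<inter> W (Suc t) \<noteq> {}" using Suc.prems by simp
  have IH: "attracts (op_prod H 0 t) (\<Inter>i\<in>{1..t}. W i)"
    using Suc.prems ne by (intro Suc.IH) auto
  have "affine (\<Inter>i\<in>{1..t}. W i)" using Suc.prems by (intro affine_Inter) auto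
  then show ?case
    unfolding eq using Suc.prems ne IH by (simp only: op_prod.simps) (intro attracts_compose; simp)
qed

text \<open>Jensen's inequality for the squared norm, obtained by expanding the nonnegative weighted
  variance about the mean \<open>s\<close>.\<close>

lemma norm_convex_comb_square_le:
  fixes y :: "'i \<Rightarrow> 'a::real_inner"
  assumes "finite I" "\<And>i. i \<in> I \<Longrightarrow> 0 \<le> w i" "sum w I = 1"
  shows "(norm (\<Sum>i\<in>I. w i *\<^sub>R y i))\<^sup>2 \<le> (\<Sum>i\<in>I. w i * (norm (y i))\<^sup>2)"
proof -
  define s where "s = (\<Sum>i\<in>I. w i *\<^sub>R y i)"
  have "0 \<le> (\<Sum>i\<in>I. w i * (norm (y i - s))\<^sup>2)"
    using assms by (intro sum_nonneg) auto
  also have "\<dots> = (\<Sum>i\<in>I. w i * (norm (y i))\<^sup>2 - 2 * ((w i *\<^sub>R y i) \<bullet> s) + w i * (s \<bullet> s))"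
    by (intro sum.cong refl)
      (simp add: power2_norm_eq_inner inner_diff inner_commute algebra_simps)
  also have "\<dots> = (\<Sum>i\<in>I. w i * (norm (y i))\<^sup>2) - 2 * (\<Sum>i\<in>I. (w i *\<^sub>R y i) \<bullet> s) + (\<Sum>i\<in>I. w i) * (s \<bullet> s)"
    unfolding sum_distrib_left sum_distrib_right by (simp only: sum.distrib sum_subtractf)
  also have "(\<Sum>i\<in>I. (w i *\<^sub>R y i) \<bullet> s) = s \<bullet> s"
    unfolding s_def inner_sum_left ..
  finally show ?thesis using assms(3) by (simp add: power2_norm_eq_inner s_def)
qed

text \<open>By Jensen the decrease is at least the weighted sum of the individual decreases.
  Positive weights bound this below by a multiple of the sum of the squared distances, which linear
  regularity compares with the distance to the intersection.\<close>

lemma attracts_convex_comb: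
  fixes W :: "'i \<Rightarrow> 'a::euclidean_space set"
  assumes I: "finite I" and H: "\<And>i. i \<in> I \<Longrightarrow> attracts (H i) (W i)"
    and W: "\<And>i. i \<in> I \<Longrightarrow> affine (W i)" "(\<Inter>i\<in>I. W i) \<noteq> {}"
    and w: "\<And>i. i \<in> I \<Longrightarrow> 0 < w i" "sum w I = 1"
  shows "attracts (\<lambda>x. \<Sum>i\<in>I. w i *\<^sub>R H i x) (\<Inter>i\<in>I. W i)"
proof -
  let ?W = "\<Inter>i\<in>I. W i"
  have "\<forall>i\<in>I. \<exists>c>0. \<forall>x. \<forall>z\<in>W i. (norm (H i x - z))\<^sup>2 \<le> (norm (x - z))\<^sup>2 - c * (infdist x (W i))\<^sup>2"
    using H unfolding attracts_def by blast
  then obtain c where c: "\<And>i. i \<in> I \<Longrightarrow> c i > 0"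
    "\<And>i x z. i \<in> I \<Longrightarrow> z \<in> W i \<Longrightarrow>
      (norm (H i x - z))\<^sup>2 \<le> (norm (x - z))\<^sup>2 - c i * (infdist x (W i))\<^sup>2"
    by metis
  have I0: "I \<noteq> {}" using w(2) by auto
  define b where "b = Min ((\<lambda>i. w i * c i) ` I)"
  have b: "b > 0" "\<And>i. i \<in> I \<Longrightarrow> b \<le> w i * c i"
    using I I0 c w unfolding b_def by auto
  obtain \<kappa> where \<kappa>: "\<kappa> > 0" "\<And>x. infdist x ?W \<le> \<kappa> * (\<Sum>i\<in>I. infdist x (W i))"
    using affine_family_regular[OF I W] by blast
  \<comment> \<open>The factor \<open>card I\<close> comes from Cauchy-Schwarz, which replaces the
    squared sum of distances by the sum of their squares.\<close>
  define M where "M = \<kappa>\<^sup>2 * real (card I)"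
  have "card I > 0" using I I0 by (simp add: card_gt_0_iff)
  then have M: "M > 0" using \<kappa>(1) by (simp add: M_def)
  have "(norm ((\<Sum>i\<in>I. w i *\<^sub>R H i x) - z))\<^sup>2 \<le> (norm (x - z))\<^sup>2 - b / M * (infdist x ?W)\<^sup>2"
    if z: "z \<in> ?W" for x z
  proof -
    have "(infdist x ?W)\<^sup>2 \<le> \<kappa>\<^sup>2 * (\<Sum>i\<in>I. infdist x (W i))\<^sup>2"
      using power_mono[OF \<kappa>(2) infdist_nonneg, of x 2] by (simp add: power_mult_distrib)
    also have "\<dots> \<le> \<kappa>\<^sup>2 * ((\<Sum>i\<in>I. (infdist x (W i))\<^sup>2) * (\<Sum>i\<in>I. 1\<^sup>2))"
      using Cauchy_Schwarz_ineq_sum[of "\<lambda>i. infdist x (W i)" "\<lambda>i. 1" I]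
      by (intro mult_left_mono) auto
    also have "\<dots> = M * (\<Sum>i\<in>I. (infdist x (W i))\<^sup>2)" by (simp add: M_def)
    finally have "b / M * (infdist x ?W)\<^sup>2 \<le> b * (\<Sum>i\<in>I. (infdist x (W i))\<^sup>2)"
      using M b by (simp add: field_simps)
    also have "\<dots> \<le> (\<Sum>i\<in>I. w i * c i * (infdist x (W i))\<^sup>2)"
      unfolding sum_distrib_left using b by (intro sum_mono mult_right_mono) auto
    finally have *: "b / M * (infdist x ?W)\<^sup>2 \<le> (\<Sum>i\<in>I. w i * c i * (infdist x (W i))\<^sup>2)" .
    have "(\<Sum>i\<in>I. w i *\<^sub>R H i x) - z = (\<Sum>i\<in>I. w i *\<^sub>R (H i x - z))"
      using w(2) by (simp add: scaleR_diff_right sum_subtractf scaleR_left.sum[symmetric])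
    then have "(norm ((\<Sum>i\<in>I. w i *\<^sub>R H i x) - z))\<^sup>2 \<le> (\<Sum>i\<in>I. w i * (norm (H i x - z))\<^sup>2)"
      using norm_convex_comb_square_le[OF I _ w(2)] w(1) by (simp add: less_imp_le)
    also have "\<dots> \<le> (\<Sum>i\<in>I. w i * ((norm (x - z))\<^sup>2 - c i * (infdist x (W i))\<^sup>2))"
      using w c(2) z by (intro sum_mono mult_left_mono) (auto simp: less_imp_le)
    also have "\<dots> = (norm (x - z))\<^sup>2 - (\<Sum>i\<in>I. w i * c i * (infdist x (W i))\<^sup>2)"
      using w(2) by (simp add: right_diff_distrib sum_subtractf sum_distrib_right[symmetric] mult.assoc)
    finally show ?thesis using * by simp
  qed
  then show ?thesis unfolding attracts_def using b M by (intro exI[of _ "b / M"]) auto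
qed

section \<open>From attraction to best approximation mappings and linear convergence\<close>

lemma attracts_Fix:
  fixes W :: "'a::euclidean_space set"
  assumes "attracts H W" "affine W" "W \<noteq> {}"
  shows "Fix H = W"
proof (intro equalityI subsetI)
  fix x assume "x \<in> W"
  then show "x \<in> Fix H" using attracts_nonexpansive[OF assms(1), of x x] by (simp add: Fix_def)
next
  fix x assume "x \<in> Fix H"
  obtain z where z: "z \<in> W" using assms by blast
  obtain c where c: "c > 0" "(norm (H x - z))\<^sup>2 \<le> (norm (x - z))\<^sup>2 - c * (infdist x W)\<^sup>2"
    using assms(1) z unfolding attracts_def by blast
  then have "c * (infdist x W)\<^sup>2 \<le> 0" using \<open>x \<in> Fix H\<close> by (simp add: Fix_def)
  then have "infdist x W = 0" using c(1) by (simp add: mult_le_0_iff)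
  then show "x \<in> W" using in_closed_iff_infdist_zero affine_closed assms by blast
qed

text \<open>Nonexpansiveness towards every point of \<open>W\<close> is essential here. If the
  projections \<open>r\<close> of \<open>H x\<close> and \<open>p\<close> of \<open>x\<close>
  differed, a point of \<open>W\<close> far beyond \<open>p\<close> on the ray from \<open>r\<close>
  would be farther from \<open>H x\<close> than from \<open>x\<close>.\<close>

lemma attracts_closest_point:
  fixes W :: "'a::euclidean_space set"
  assumes H: "attracts H W" and W: "affine W" "W \<noteq> {}"
  shows "closest_point W (H x) = closest_point W x"
proof -
  define p r where "p = closest_point W x" and "r = closest_point W (H x)"
  have pr: "p \<in> W" "r \<in> W"
    unfolding p_def r_def using W closest_point_in_set affine_closed by blast+
  define D where "D = (norm (r - p))\<^sup>2"
  \<comment> \<open>Compare the distances from \<open>x\<close> and \<open>H x\<close> to a point moving along the line through \<open>r\<close> and \<open>p\<close>.\<close>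
  have *: "(2 * s - 1) * D \<le> (norm (x - p))\<^sup>2" for s
  proof -
    let ?z = "r + s *\<^sub>R (p - r)"
    have z: "?z \<in> W" using affine_shift_mem W(1) pr by blast
    have "r - ?z = s *\<^sub>R (r - p)" by (simp add: algebra_simps)
    moreover have "p - ?z = (s - 1) *\<^sub>R (r - p)" by (simp add: algebra_simps)
    ultimately have "(norm (H x - r))\<^sup>2 + s\<^sup>2 * D \<le> (norm (x - p))\<^sup>2 + (s - 1)\<^sup>2 * D"
      using closest_point_affine_Pythagoras[OF W(1) z, of x]
        closest_point_affine_Pythagoras[OF W(1) z, of "H x"]
        power_mono[OF attracts_nonexpansive[OF H z, of x], of 2]
      by (simp add: p_def[symmetric] r_def[symmetric] D_def power_mult_distrib)
    then have "s\<^sup>2 * D \<le> (norm (x - p))\<^sup>2 + (s - 1)\<^sup>2 * D"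
      using zero_le_power2[of "norm (H x - r)"] by linarith
    then show ?thesis by (simp add: power2_eq_square algebra_simps)
  qed
  have "D = 0"
  proof (rule ccontr)
    assume "D \<noteq> 0"
    \<comment> \<open>This \<open>s\<close> makes \<open>(2 * s - 1) * D\<close> equal to
      \<open>(norm (x - p))\<^sup>2 + D\<close>, which exceeds the bound as \<open>D\<close> is
      positive.\<close>
    then show False using *[of "((norm (x - p))\<^sup>2 / D + 2) / 2"] by (simp add: D_def algebra_simps)
  qed
  then show ?thesis by (simp add: D_def p_def r_def)
qed

lemma attracts_contracts:
  fixes W :: "'a::euclidean_space set"
  assumes "attracts H W" "affine W" "W \<noteq> {}"
  obtains \<gamma> where "0 \<le> \<gamma>" "\<gamma> < 1"
    "\<And>x. norm (H x - closest_point W x) \<le> \<gamma> * norm (x - closest_point W x)"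
proof -
  obtain c where c: "c > 0" "c \<le> 1"
    "\<And>x z. z \<in> W \<Longrightarrow> (norm (H x - z))\<^sup>2 \<le> (norm (x - z))\<^sup>2 - c * (infdist x W)\<^sup>2"
    using attractsE[OF assms(1)] by metis
  show ?thesis
  \<comment> \<open>With \<open>z\<close> the projection of \<open>x\<close>, the distance to
    \<open>W\<close> is \<open>norm (x - z)\<close> itself, so the squared norm shrinks by the
    factor \<open>1 - c\<close>.\<close>
  proof (rule that[of "sqrt (1 - c)"])
    fix x
    let ?p = "closest_point W x"
    have "?p \<in> W" using assms closest_point_in_set affine_closed by blast
    then have "(norm (H x - ?p))\<^sup>2 \<le> (1 - c) * (norm (x - ?p))\<^sup>2"
      using c(3)[of ?p x] infdist_eq_norm_closest_point[OF assms(2,3), of x]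
      by (simp add: left_diff_distrib)
    then have "sqrt ((norm (H x - ?p))\<^sup>2) \<le> sqrt ((1 - c) * (norm (x - ?p))\<^sup>2)"
      by (rule real_sqrt_le_mono)
    then show "norm (H x - ?p) \<le> sqrt (1 - c) * norm (x - ?p)"
      by (simp add: real_sqrt_mult)
  qed (use c in auto)
qed

lemma funpow_linear_convergence:
  fixes H :: "'a::real_normed_vector \<Rightarrow> 'a"
  assumes "0 \<le> \<gamma>" "\<And>x. P (H x) = P x" "\<And>x. norm (H x - P x) \<le> \<gamma> * norm (x - P x)"
  shows "norm ((H ^^ k) x - P x) \<le> \<gamma> ^ k * norm (x - P x)"
proof (induction k)
  case 0
  show ?case by simp
next
  case (Suc k)
  \<comment> \<open>The projection is constant along the orbit, so every step contracts towards the
    same point.\<close>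
  have "P ((H ^^ k) x) = P x" by (induction k) (simp_all add: assms(2))
  then have "norm ((H ^^ Suc k) x - P x) \<le> \<gamma> * norm ((H ^^ k) x - P x)"
    using assms(3)[of "(H ^^ k) x"] by simp
  also have "\<dots> \<le> \<gamma> * (\<gamma> ^ k * norm (x - P x))"
    using Suc assms(1) by (rule mult_left_mono)
  finally show ?case by simp
qed

section \<open>Products of consecutive operators and the index ranges of the blocks\<close>

lemma op_prod_affine_isometry:
  assumes "\<And>i. i \<in> {a<..a + j} \<Longrightarrow> affine_map (T i) \<and> isometry (T i)"
  shows "affine_map (op_prod T a j) \<and> isometry (op_prod T a j)"
  using assms
proof (induction j)
  case 0
  show ?case by (simp add: affine_map_def isometry_def)
next
  case (Suc j)
  then have "affine_map (op_prod T a j) \<and> isometry (op_prod T a j)" by simp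
  moreover have "affine_map (T (a + Suc j)) \<and> isometry (T (a + Suc j))" using Suc.prems by simp
  ultimately show ?case by (simp add: affine_map_def isometry_def)
qed

text \<open>If \<open>x\<close> is fixed by the product of length \<open>n\<close>, then the product
  of length \<open>n + 1\<close> sends \<open>x\<close> to \<open>T (a + Suc n) x\<close>. Thus, one
  length at a time, fixing the next product amounts to fixing the next factor.\<close>

lemma Fix_op_prods:
  "(\<Inter>j\<in>{0..n}. Fix (op_prod T a j)) = (\<Inter>i\<in>{a<..a + n}. Fix (T i))"
proof (induction n)
  case 0
  show ?case by (simp add: Fix_def)
next
  case (Suc n)
  have "{a<..a + Suc n} = insert (a + Suc n) {a<..a + n}" by auto
  then have "(\<Inter>i\<in>{a<..a + Suc n}. Fix (T i)) =
      Fix (T (a + Suc n)) \<inter> (\<Inter>j\<in>{0..n}. Fix (op_prod T a j))"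
    using Suc by simp
  also have "\<dots> = Fix (op_prod T a (Suc n)) \<inter> (\<Inter>j\<in>{0..n}. Fix (op_prod T a j))"
    by (fastforce simp: Fix_def)
  also have "\<dots> = (\<Inter>j\<in>{0..Suc n}. Fix (op_prod T a j))"
    by (simp add: atLeast0_atMost_Suc)
  finally show ?case by simp
qed

lemma UN_consecutive_intervals:
  fixes q :: "nat \<Rightarrow> nat"
  assumes "\<And>i. i \<in> {1..t} \<Longrightarrow> q (i - 1) \<le> q i"
  shows "(\<Union>i\<in>{1..t}. {q (i - 1)<..q i}) = {q 0<..q t}"
  using assms
proof (induction t)
  case (Suc t)
  \<comment> \<open>Monotonicity up to \<open>t\<close> yields
    \<open>q 0 \<le> q t \<le> q (Suc t)\<close>, so the last interval adjoins the union of the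
    earlier ones without a gap.\<close>
  have "q 0 \<le> q i" if "i \<le> t" for i
    using that
  proof (induction i)
    case (Suc i)
    then show ?case using Suc.prems \<open>\<And>i. i \<in> {1..Suc t} \<Longrightarrow> q (i - 1) \<le> q i\<close>[of "Suc i"] by simp
  qed simp
  then have "q 0 \<le> q t" by simp
  moreover have "q t \<le> q (Suc t)" using Suc.prems[of "Suc t"] by simp
  ultimately have "{q 0<..q (Suc t)} = {q t<..q (Suc t)} \<union> {q 0<..q t}" by auto
  then show ?case using Suc by (simp add: atLeastAtMostSuc_conv)
qed simp

section \<open>Attraction for both combinations of the block circumcenter mappings\<close>

theorem theorem6p27:
  fixes T :: "nat \<Rightarrow> real ^ 'n \<Rightarrow> real ^ 'n"
    and G :: "real ^ 'n \<Rightarrow> real ^ 'n"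
    and m t :: nat
    and q :: "nat \<Rightarrow> nat"
  assumes "m \<ge> 1"
    and "\<And>i. i \<in> {1..m} \<Longrightarrow> affine_map (T i) \<and> isometry (T i)"
    and "(\<Inter>i\<in>{1..m}. Fix (T i)) \<noteq> {}"
    and "t \<ge> 1"
    and "q 0 = 0" and "q t = m"
    and "\<And>i. i \<in> {1..t} \<Longrightarrow> q (i - 1) + 1 \<le> q i"
    and "G = op_prod (\<lambda>i. CC (block T q i)) 0 t \<or>
         (\<exists>\<omega> :: nat \<Rightarrow> real.
            (\<forall>i\<in>{1..t}. 0 < \<omega> i \<and> \<omega> i \<le> 1) \<and> (\<Sum>i=1..t. \<omega> i) = 1 \<and>
            G = (\<lambda>x. \<Sum>i=1..t. \<omega> i *\<^sub>R CC (block T q i) x))"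
  shows "Fix G = (\<Inter>i\<in>{1..m}. Fix (T i)) \<and>
    is_BAM G \<and>
    (\<exists>\<gamma>::real. 0 \<le> \<gamma> \<and> \<gamma> < 1 \<and>
      (\<forall>x. \<forall>k::nat.
        norm ((G ^^ k) x - closest_point (\<Inter>i\<in>{1..m}. Fix (T i)) x)
          \<le> \<gamma> ^ k * norm (x - closest_point (\<Inter>i\<in>{1..m}. Fix (T i)) x)))"
proof -
  let ?F = "\<Inter>i\<in>{1..m}. Fix (T i)"
  note q = assms(7)
  have cover: "(\<Union>i\<in>{1..t}. {q (i - 1)<..q i}) = {1..m}"
    using UN_consecutive_intervals[of t q] q assms(5,6) by fastforce
  define W where "W i = (\<Inter>h\<in>block T q i. Fix h)" for i
  \<comment> \<open>The factors in block \<open>i\<close> are exactly those with index in the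
    half-open range; as \<open>q (i - 1) \<le> q i\<close>, the subtraction in \<open>block\<close>
    does not truncate.\<close>
  have W: "W i = (\<Inter>k\<in>{q (i - 1)<..q i}. Fix (T k))" if "i \<in> {1..t}" for i
    using Fix_op_prods[where n = "q i - q (i - 1)" and a = "q (i - 1)" and T = T] q[OF that]
    by (simp add: W_def block_def)
  have F: "(\<Inter>i\<in>{1..t}. W i) = ?F"
  proof -
    have "(\<Inter>i\<in>{1..t}. W i) = (\<Inter>i\<in>{1..t}. \<Inter>k\<in>{q (i - 1)<..q i}. Fix (T k))"
      using W by (intro INF_cong refl)
    also have "\<dots> = (\<Inter>k\<in>(\<Union>i\<in>{1..t}. {q (i - 1)<..q i}). Fix (T k))" by blast
    finally show ?thesis unfolding cover .
  qed
  have blk: "affine_map h \<and> isometry h" if i: "i \<in> {1..t}" and h: "h \<in> block T q i" for i h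
  proof -
    obtain j where j: "j \<le> q i - q (i - 1)" "h = op_prod T (q (i - 1)) j"
      using h by (auto simp: block_def)
    have "{q (i - 1)<..q (i - 1) + j} \<subseteq> {q (i - 1)<..q i}" using j(1) q[OF i] by auto
    also have "\<dots> \<subseteq> {1..m}" using cover i by blast
    finally show ?thesis unfolding j(2) using assms(2) by (intro op_prod_affine_isometry) blast
  qed
  \<comment> \<open>The product of length 0 is the identity, so each orbit contains its base point,
    as \<open>attracts_CC\<close> requires.\<close>
  have id: "id \<in> block T q i" for i by (force simp: block_def intro: image_eqI[of _ _ 0])
  have Wne: "(\<Inter>i\<in>{1..t}. W i) \<noteq> {}" using F assms(3) by simp
  have affW: "affine (W i)" if "i \<in> {1..t}" for i
    unfolding W_def using blk[OF that] affine_Fix by (intro affine_Inter) auto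
  have att: "attracts (CC (block T q i)) (W i)" if "i \<in> {1..t}" for i
    unfolding W_def
  proof (rule attracts_CC)
    have "W i \<noteq> {}" using Wne that by blast
    then show "(\<Inter>h\<in>block T q i. Fix h) \<noteq> {}" unfolding W_def .
  qed (use blk[OF that] id in \<open>auto simp: block_def\<close>)
  have G: "attracts G ?F"
    using assms(8)
  proof
    assume "G = op_prod (\<lambda>i. CC (block T q i)) 0 t"
    then show ?thesis using attracts_op_prod[OF att affW Wne] F by simp
  next
    assume "\<exists>\<omega> :: nat \<Rightarrow> real.
      (\<forall>i\<in>{1..t}. 0 < \<omega> i \<and> \<omega> i \<le> 1) \<and> (\<Sum>i=1..t. \<omega> i) = 1 \<and>
      G = (\<lambda>x. \<Sum>i=1..t. \<omega> i *\<^sub>R CC (block T q i) x)"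
    then obtain \<omega> :: "nat \<Rightarrow> real" where \<omega>: "\<And>i. i \<in> {1..t} \<Longrightarrow> 0 < \<omega> i" "(\<Sum>i=1..t. \<omega> i) = 1"
      "G = (\<lambda>x. \<Sum>i=1..t. \<omega> i *\<^sub>R CC (block T q i) x)" by blast
    show ?thesis
      unfolding \<omega>(3) F[symmetric] by (rule attracts_convex_comb[OF _ att affW Wne \<omega>(1,2)]) auto
  qed
  have affF: "affine ?F" using affine_Fix assms(2) by (intro affine_Inter) blast
  have Fix: "Fix G = ?F" using attracts_Fix[OF G affF assms(3)] .
  have P: "closest_point ?F (G x) = closest_point ?F x" for x
    using attracts_closest_point[OF G affF assms(3)] .
  obtain \<gamma> where \<gamma>: "0 \<le> \<gamma>" "\<gamma> < 1"
    "\<And>x. norm (G x - closest_point ?F x) \<le> \<gamma> * norm (x - closest_point ?F x)"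
    using attracts_contracts[OF G affF assms(3)] by metis
  have "is_BAM_with \<gamma> G"
    unfolding is_BAM_with_def Fix
    using \<gamma> P assms(3) affF by (auto simp: affine_closed affine_imp_convex)
  moreover have "norm ((G ^^ k) x - closest_point ?F x) \<le> \<gamma> ^ k * norm (x - closest_point ?F x)" for x k
    using funpow_linear_convergence[where P = "closest_point ?F", OF \<gamma>(1) P \<gamma>(3)] .
  ultimately show ?thesis using Fix \<gamma> unfolding is_BAM_def by blast
qed

end
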